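(* Let $M,A\in\mathbb R^{N\times N}$ be symmetric positive definite, $\phi>0$, let $\mathcal I\subseteq\{1,\dots,N\}$ be a nonempty index set, and set $Q_0=M_{\mathcal I\mathcal I}$ and $Q_1=-\frac1\phi A_{\mathcal I\mathcal I}$. Then the nonconvex quadratically constrained quadratic program $$\min_{\Upsilon\in\mathbb R^{|\mathcal I|}}\ \Upsilon^TQ_0\Upsilon\quad\text{subject to}\quad \Upsilon^TQ_1\Upsilon\le -1,\quad \Upsilon^T\Upsilon=1$$ and its semidefinite relaxation $$\min_{Y\in\mathcal S^{|\mathcal I|}}\ \operatorname{Tr}(Q_0Y)\quad\text{subject to}\quad \operatorname{Tr}(Q_1Y)\le -1,\quad \operatorname{Tr}(Y)=1,\quad Y\succeq 0$$ have the same optimal value.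
   Context: $M_{\mathcal I\mathcal I}$ denotes the principal submatrix of $M$ with rows and columns indexed by $\mathcal I$ (similarly $A_{\mathcal I\mathcal I}$). $\mathcal S^m$ is the space of real symmetric $m\times m$ matrices, and $Y\succeq0$ means positive semidefinite. The optimal value of an infeasible minimization problem is $+\infty$. *)

theory Defs
  imports "HOL-Library.Extended_Real" "Jordan_Normal_Form.DL_Submatrix"
begin

text \<open>
  Matrix indices are 0-based, so index sets are subsets of \<open>{..<N}\<close>; the principal submatrix of
  \<open>M\<close> on \<open>I\<close> is \<^term>\<open>submatrix M I I\<close>, which lists the elements of \<open>I\<close> in increasing order.
\<close>

definition sym_mats :: "nat \<Rightarrow> real mat set" where
  "sym_mats n = {A \<in> carrier_mat n n. A\<^sup>T = A}"

definition quad_form :: "real mat \<Rightarrow> real vec \<Rightarrow> real" where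
  "quad_form A v = v \<bullet> (A *\<^sub>v v)"

definition sym_pos_def :: "nat \<Rightarrow> real mat \<Rightarrow> bool" where
  "sym_pos_def n A \<longleftrightarrow>
     A \<in> sym_mats n \<and> (\<forall>v \<in> carrier_vec n. v \<noteq> 0\<^sub>v n \<longrightarrow> 0 < quad_form A v)"

definition sym_pos_semidef :: "nat \<Rightarrow> real mat \<Rightarrow> bool" where
  "sym_pos_semidef n A \<longleftrightarrow> A \<in> sym_mats n \<and> (\<forall>v \<in> carrier_vec n. 0 \<le> quad_form A v)"

definition mat_trace :: "real mat \<Rightarrow> real" where
  "mat_trace A = (\<Sum>i<dim_row A. A $$ (i, i))"

text \<open>
  Optimal values are infima in the extended reals, where the infimum of the empty set is \<open>\<infinity>\<close>.
\<close>

definition qcqp_feasible :: "nat \<Rightarrow> real mat \<Rightarrow> real vec set" where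
  "qcqp_feasible m Q1 = {v \<in> carrier_vec m. quad_form Q1 v \<le> - 1 \<and> v \<bullet> v = 1}"

definition qcqp_value :: "nat \<Rightarrow> real mat \<Rightarrow> real mat \<Rightarrow> ereal" where
  "qcqp_value m Q0 Q1 = (INF v \<in> qcqp_feasible m Q1. ereal (quad_form Q0 v))"

definition sdp_feasible :: "nat \<Rightarrow> real mat \<Rightarrow> real mat set" where
  "sdp_feasible m Q1 =
     {Y \<in> sym_mats m. mat_trace (Q1 * Y) \<le> - 1 \<and> mat_trace Y = 1 \<and> sym_pos_semidef m Y}"

definition sdp_value :: "nat \<Rightarrow> real mat \<Rightarrow> real mat \<Rightarrow> ereal" where
  "sdp_value m Q0 Q1 = (INF Y \<in> sdp_feasible m Q1. ereal (mat_trace (Q0 * Y)))"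

end

theory Submission
  imports Defs
begin

text \<open>
  A feasible \<open>Y\<close> of the relaxation is a sum of rank one matrices \<open>v v\<^sup>T\<close>. Put \<open>G = Q1 + 1\<close> and
  \<open>H = Q0 - c 1\<close> with \<open>c > Tr (Q0 Y)\<close>; then the \<open>G\<close>-forms of the vectors sum to at most \<open>0\<close> and the
  \<open>H\<close>-forms to less than \<open>0\<close>. Following Sturm and Zhang, two of the vectors with \<open>G\<close>-forms of
  opposite sign can be rotated in their plane without changing the sum of their rank one matrices,
  so that one of them becomes \<open>G\<close>-isotropic. Either its \<open>H\<close>-form is negative or it can be discarded,
  so eventually a single vector has nonpositive \<open>G\<close>-form and negative \<open>H\<close>-form. Normalised, it
  is feasible for the quadratic program with objective value below \<open>c\<close>.
\<close>

section \<open>Algebra of quadratic forms\<close>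

lemma quad_form_sum:
  assumes "A \<in> carrier_mat n n" "v \<in> carrier_vec n"
  shows "quad_form A v = (\<Sum>i<n. \<Sum>j<n. A $$ (i, j) * (v $ i * v $ j))"
  using assms
  by (auto simp: quad_form_def scalar_prod_def sum_distrib_left atLeast0LessThan mult_ac intro!: sum.cong)

lemma quad_form_smult_vec:
  assumes "A \<in> carrier_mat n n" "v \<in> carrier_vec n"
  shows "quad_form A (a \<cdot>\<^sub>v v) = a\<^sup>2 * quad_form A v"
  using assms by (simp add: quad_form_def mult_mat_vec power2_eq_square)

lemma quad_form_add:
  assumes "A \<in> carrier_mat n n" "x \<in> carrier_vec n" "y \<in> carrier_vec n"
  shows "quad_form A (x + y) = quad_form A x + (x \<bullet> (A *\<^sub>v y) + y \<bullet> (A *\<^sub>v x)) + quad_form A y"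
  using assms
  by (simp add: quad_form_def mult_add_distrib_mat_vec[of A n n] scalar_prod_add_distrib[of _ n]
      add_scalar_prod_distrib[of _ n])

lemma quad_form_lincomb:
  assumes A: "A \<in> carrier_mat n n" and x: "x \<in> carrier_vec n" and y: "y \<in> carrier_vec n"
  shows "quad_form A (a \<cdot>\<^sub>v x + b \<cdot>\<^sub>v y)
    = a\<^sup>2 * quad_form A x + a * b * (x \<bullet> (A *\<^sub>v y) + y \<bullet> (A *\<^sub>v x)) + b\<^sup>2 * quad_form A y"
  using assms
  by (simp add: quad_form_add[of A n] quad_form_smult_vec[of A n] mult_mat_vec[of A n n] algebra_simps)

lemma quad_form_add_smult_one:
  assumes "A \<in> carrier_mat n n" "v \<in> carrier_vec n"
  shows "quad_form (A + c \<cdot>\<^sub>m 1\<^sub>m n) v = quad_form A v + c * (v \<bullet> v)"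
proof -
  have "(c \<cdot>\<^sub>m 1\<^sub>m n) *\<^sub>v v = c \<cdot>\<^sub>v v"
    using assms by (intro eq_vecI) (auto simp: smult_scalar_prod_distrib[of _ n])
  then show ?thesis
    using assms by (simp add: quad_form_def add_mult_distrib_mat_vec[of A n n] scalar_prod_add_distrib[of _ n])
qed

section \<open>Rank one decomposition of positive semidefinite matrices\<close>

text \<open>The form is nonnegative on every combination of \<open>x\<close> and \<open>y\<close>;
  two choices of coefficients give the bound. It controls the pivot step of the elimination
  below.\<close>

lemma sym_pos_semidef_Cauchy_Schwarz:
  assumes Y: "sym_pos_semidef n Y" and x: "x \<in> carrier_vec n" and y: "y \<in> carrier_vec n"
  shows "(x \<bullet> (Y *\<^sub>v y))\<^sup>2 \<le> quad_form Y x * quad_form Y y"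
proof -
  define a b c where "a = quad_form Y x" and "b = x \<bullet> (Y *\<^sub>v y)" and "c = quad_form Y y"
  have Yc: "Y \<in> carrier_mat n n" "Y\<^sup>T = Y"
    using Y by (auto simp: sym_pos_semidef_def sym_mats_def)
  have "y \<bullet> (Y *\<^sub>v x) = b"
    unfolding b_def using Yc x y
    by (metis comm_scalar_prod mult_mat_vec_carrier transpose_vec_mult_scalar)
  then have pos: "0 \<le> s\<^sup>2 * a + s * t * (2 * b) + t\<^sup>2 * c" for s t
  proof -
    have "0 \<le> quad_form Y (s \<cdot>\<^sub>v x + t \<cdot>\<^sub>v y)"
      using Y x y unfolding sym_pos_semidef_def by simp
    then show ?thesis
      using \<open>y \<bullet> (Y *\<^sub>v x) = b\<close>
      unfolding quad_form_lincomb[OF Yc(1) x y] by (simp add: a_def b_def c_def)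
  qed
  have a: "0 \<le> a" and c: "0 \<le> c"
    using pos[of 1 0] pos[of 0 1] by auto
  show ?thesis
  proof (cases "c = 0")
    case True
    \<comment> \<open>For \<open>c = 0\<close> the inequality \<open>pos\<close> is affine in
      \<open>t\<close>. This choice of coefficients turns its right side into
      \<open>- b\<^sup>2 * (a + 2)\<close>.\<close>
    have "0 \<le> b\<^sup>2 * a + b * (- (a + 1)) * (2 * b)"
      using pos[of b "- (a + 1)"] True by simp
    then have "b\<^sup>2 * (a + 2) \<le> 0"
      by (simp add: algebra_simps power2_eq_square)
    then have "b = 0"
      using a by (smt (verit) mult_pos_pos zero_less_power2)
    then show ?thesis using True by (simp add: a_def b_def c_def)
  next
    case False
    \<comment> \<open>The coefficients \<open>c\<close> and \<open>- b\<close> minimise the form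
      along the direction \<open>y\<close>, up to scaling.\<close>
    have "0 \<le> c * (a * c - b\<^sup>2)"
      using pos[of c "- b"] by (simp add: algebra_simps power2_eq_square)
    then have "0 \<le> a * c - b\<^sup>2"
      using c False by (simp add: zero_le_mult_iff)
    then show ?thesis by (simp add: a_def b_def c_def)
  qed
qed

lemma scalar_prod_mult_unit_vec:
  fixes A :: "real mat"
  assumes "A \<in> carrier_mat n n" "v \<in> carrier_vec n" "k < n"
  shows "v \<bullet> (A *\<^sub>v unit_vec n k) = (\<Sum>i<n. v $ i * A $$ (i, k))"
proof -
  have "A *\<^sub>v unit_vec n k = col A k"
    using assms by (intro eq_vecI) auto
  then show ?thesis
    using assms by (auto simp: scalar_prod_def atLeast0LessThan intro!: sum.cong)
qed

lemma quad_form_unit_vec: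
  assumes "A \<in> carrier_mat n n" "k < n"
  shows "quad_form A (unit_vec n k) = A $$ (k, k)"
  using assms unfolding quad_form_def by simp

text \<open>
  The induction is the Cholesky elimination: \<open>k\<close> bounds the rows that are not yet cleared.
\<close>

lemma sym_pos_semidef_rank_one_decomposition_aux:
  assumes "sym_pos_semidef n Y" "k \<le> n"
    and "\<And>i j. i < n \<Longrightarrow> j < n \<Longrightarrow> k \<le> i \<Longrightarrow> Y $$ (i, j) = 0"
  shows "\<exists>vs. set vs \<subseteq> carrier_vec n \<and>
    (\<forall>i<n. \<forall>j<n. Y $$ (i, j) = (\<Sum>v\<leftarrow>vs. v $ i * v $ j))"
  using assms
proof (induction k arbitrary: Y)
  case 0
  then show ?case by (intro exI[of _ "[]"]) auto
next
  case (Suc k)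
  note Y = Suc.prems(1) and k = Suc.prems(2) and zero = Suc.prems(3)
  have Yc: "Y \<in> carrier_mat n n" and Yt: "Y\<^sup>T = Y"
    using Y by (auto simp: sym_pos_semidef_def sym_mats_def)
  have sym: "Y $$ (i, j) = Y $$ (j, i)" if "i < n" "j < n" for i j
    using that Yc Yt by (metis carrier_matD index_transpose_mat(1))
  have kn: "k < n" using k by simp
  define e :: "real vec" where "e = unit_vec n k"
  have e: "e \<in> carrier_vec n" by (simp add: e_def)
  have qe: "quad_form Y e = Y $$ (k, k)"
    using quad_form_unit_vec[OF Yc kn] by (simp add: e_def)
  have d: "0 \<le> Y $$ (k, k)"
    using Y e qe by (metis sym_pos_semidef_def)
  show ?case
  proof (cases "Y $$ (k, k) = 0")
    case True
    \<comment> \<open>A zero pivot: Cauchy-Schwarz against \<open>e\<close> clears the whole row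
      \<open>k\<close>, so the induction hypothesis applies to \<open>Y\<close> itself.\<close>
    have row: "Y $$ (k, j) = 0" if j: "j < n" for j
    proof -
      have "(unit_vec n j \<bullet> (Y *\<^sub>v e))\<^sup>2 \<le> 0"
        using sym_pos_semidef_Cauchy_Schwarz[OF Y _ e, of "unit_vec n j"] qe True by simp
      then show ?thesis
        using Yc j kn sym[of j k] by (simp add: e_def)
    qed
    show ?thesis
    proof (rule Suc.IH[OF Y])
      fix i j assume "i < n" "j < n" "k \<le> i"
      then show "Y $$ (i, j) = 0"
        using row zero[of i j] by (cases "i = k") auto
    qed (use kn in simp)
  next
    case False
    define d where "d = Y $$ (k, k)"
    have d: "0 < d" using d False by (simp add: d_def)
    \<comment> \<open>The scaling makes \<open>u u^T\<close> agree with \<open>Y\<close> in row and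
      column \<open>k\<close>. Thus \<open>Z\<close> is the Schur complement of the pivot, padded
      with zeros.\<close>
    define u where "u = vec n (\<lambda>i. Y $$ (i, k) / sqrt d)"
    define Z where "Z = mat n n (\<lambda>(i, j). Y $$ (i, j) - u $ i * u $ j)"
    have u: "u \<in> carrier_vec n" and Zc: "Z \<in> carrier_mat n n"
      by (simp_all add: u_def Z_def)
    have uu: "u $ i * u $ j = Y $$ (i, k) * Y $$ (j, k) / d" if "i < n" "j < n" for i j
      using that d by (simp add: u_def)
    have Z_entry: "Z $$ (i, j) = Y $$ (i, j) - u $ i * u $ j" if "i < n" "j < n" for i j
      using that by (simp add: Z_def)
    \<comment> \<open>The subtracted square is
      \<open>(v \<bullet> (Y *\<^sub>v e))\<^sup>2 / d\<close>. By Cauchy-Schwarz and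
      \<open>quad_form Y e = d\<close> it is at most \<open>quad_form Y v\<close>.\<close>
    have "sym_pos_semidef n Z"
      unfolding sym_pos_semidef_def sym_mats_def
    proof (intro conjI CollectI ballI)
      show "Z\<^sup>T = Z"
        using sym by (intro eq_matI) (auto simp: Z_def)
      fix v :: "real vec" assume v: "v \<in> carrier_vec n"
      have "quad_form Z v = (\<Sum>i<n. \<Sum>j<n. Y $$ (i, j) * (v $ i * v $ j) - (v $ i * u $ i) * (v $ j * u $ j))"
        unfolding quad_form_sum[OF Zc v] by (intro sum.cong refl) (simp add: Z_entry algebra_simps)
      also have "\<dots> = quad_form Y v - (\<Sum>i<n. v $ i * u $ i)\<^sup>2"
        by (simp only: quad_form_sum[OF Yc v] power2_eq_square sum_product sum_subtractf)
      finally have Zv: "quad_form Z v = quad_form Y v - (\<Sum>i<n. v $ i * u $ i)\<^sup>2" .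
      have "(\<Sum>i<n. v $ i * u $ i) = (v \<bullet> (Y *\<^sub>v e)) / sqrt d"
        unfolding e_def scalar_prod_mult_unit_vec[OF Yc v kn] by (simp add: u_def sum_divide_distrib)
      then have "(\<Sum>i<n. v $ i * u $ i)\<^sup>2 = (v \<bullet> (Y *\<^sub>v e))\<^sup>2 / d"
        using d by (simp add: power_divide)
      also have "\<dots> \<le> quad_form Y v"
        using sym_pos_semidef_Cauchy_Schwarz[OF Y v e] d qe by (simp add: d_def divide_le_eq)
      finally show "0 \<le> quad_form Z v"
        using Zv by simp
    qed (rule Zc)
    moreover have "Z $$ (i, j) = 0" if "i < n" "j < n" "k \<le> i" for i j
    proof (cases "i = k")
      case True
      then show ?thesis
        using that uu[of i j] d sym[of j k] by (simp add: Z_def d_def)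
    next
      \<comment> \<open>Below the pivot \<open>Y $$ (i, k)\<close> vanishes, hence so does
        \<open>u $ i\<close>, and the subtraction keeps the cleared rows zero.\<close>
      case False
      then show ?thesis
        using that uu[of i j] zero[of i j] zero[of i k] kn by (simp add: Z_def)
    qed
    ultimately obtain vs where vs: "set vs \<subseteq> carrier_vec n"
      "\<forall>i<n. \<forall>j<n. Z $$ (i, j) = (\<Sum>v\<leftarrow>vs. v $ i * v $ j)"
      using Suc.IH[of Z] kn by auto
    have "Y $$ (i, j) = (\<Sum>v\<leftarrow>u # vs. v $ i * v $ j)" if "i < n" "j < n" for i j
    proof -
      have "Y $$ (i, j) = u $ i * u $ j + Z $$ (i, j)"
        using that by (simp add: Z_def)
      then show ?thesis using vs that by simp
    qed
    then show ?thesis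
      using u vs by (intro exI[of _ "u # vs"]) auto
  qed
qed

lemma sym_pos_semidef_rank_one_decomposition:
  assumes "sym_pos_semidef n Y"
  obtains vs where "set vs \<subseteq> carrier_vec n"
    and "\<And>i j. i < n \<Longrightarrow> j < n \<Longrightarrow> Y $$ (i, j) = (\<Sum>v\<leftarrow>vs. v $ i * v $ j)"
  \<comment> \<open>At \<open>k = n\<close> the condition on cleared rows is vacuous.\<close>
  using sym_pos_semidef_rank_one_decomposition_aux[OF assms order_refl] by auto

section \<open>Traces as sums of quadratic forms\<close>

text \<open>By linearity this reduces to \<open>Tr (B v v^T) = v^T B v\<close>.\<close>

lemma mat_trace_mult_rank_one_sum:
  assumes B: "B \<in> carrier_mat n n" and Y: "Y \<in> carrier_mat n n"
    and vs: "set vs \<subseteq> carrier_vec n"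
    and sum: "\<And>i j. i < n \<Longrightarrow> j < n \<Longrightarrow> Y $$ (i, j) = (\<Sum>v\<leftarrow>vs. v $ i * v $ j)"
  shows "mat_trace (B * Y) = (\<Sum>v\<leftarrow>vs. quad_form B v)"
proof -
  have "mat_trace (B * Y) = (\<Sum>i<n. \<Sum>j<n. B $$ (i, j) * Y $$ (j, i))"
    using B Y by (auto simp: mat_trace_def scalar_prod_def atLeast0LessThan intro!: sum.cong)
  also have "\<dots> = (\<Sum>i<n. \<Sum>j<n. B $$ (i, j) * (\<Sum>v\<leftarrow>vs. v $ i * v $ j))"
    by (intro sum.cong refl) (simp add: sum mult.commute)
  also have "\<dots> = (\<Sum>v\<leftarrow>vs. \<Sum>i<n. \<Sum>j<n. B $$ (i, j) * (v $ i * v $ j))"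
    by (induction vs) (simp_all add: algebra_simps sum.distrib)
  also have "\<dots> = (\<Sum>v\<leftarrow>vs. quad_form B v)"
    using vs by (intro arg_cong[where f = sum_list] map_cong refl) (auto simp: quad_form_sum[OF B])
  finally show ?thesis .
qed

lemma mat_trace_rank_one_sum:
  assumes Y: "Y \<in> carrier_mat n n" and vs: "set vs \<subseteq> carrier_vec n"
    and sum: "\<And>i j. i < n \<Longrightarrow> j < n \<Longrightarrow> Y $$ (i, j) = (\<Sum>v\<leftarrow>vs. v $ i * v $ j)"
  shows "mat_trace Y = (\<Sum>v\<leftarrow>vs. v \<bullet> v)"
proof -
  have "mat_trace Y = (\<Sum>v\<leftarrow>vs. quad_form (1\<^sub>m n) v)"
    using mat_trace_mult_rank_one_sum[OF one_carrier_mat Y vs sum] Y by simp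
  also have "\<dots> = (\<Sum>v\<leftarrow>vs. v \<bullet> v)"
    using vs by (intro arg_cong[where f = sum_list] map_cong refl) (auto simp: quad_form_def)
  finally show ?thesis .
qed

section \<open>The Sturm-Zhang rotation\<close>

text \<open>Opposite signs of the outer coefficients make the discriminant positive, so the
  quadratic formula yields a real root.\<close>

lemma quadratic_root_of_opposite_signs:
  fixes a b c :: real
  assumes "0 < a" "c < 0"
  obtains t where "a + t * b + t\<^sup>2 * c = 0"
proof
  define D where "D = sqrt (b\<^sup>2 - 4 * a * c)"
  have "0 \<le> b\<^sup>2 - 4 * a * c"
    using assms by (smt (verit) mult_pos_neg zero_le_power2)
  then have D: "D\<^sup>2 = b\<^sup>2 - 4 * a * c"
    by (simp add: D_def)
  define t where "t = (D - b) / (2 * c)"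
  have "2 * c * t + b = D"
    using assms by (simp add: t_def)
  then have "(2 * c * t + b)\<^sup>2 = b\<^sup>2 - 4 * a * c"
    using D by simp
  then have "4 * c * (a + t * b + t\<^sup>2 * c) = 0"
    by (simp add: power2_eq_square algebra_simps)
  then show "a + t * b + t\<^sup>2 * c = 0"
    using assms by simp
qed

text \<open>\<open>G\<close> changes sign between \<open>x\<close> and \<open>y\<close>, so some
  \<open>x + t y\<close> is isotropic. Scaling by \<open>r\<close> makes the passage from
  \<open>(x, y)\<close> to \<open>(z, w)\<close> orthogonal, so
  \<open>z z^T + w w^T = x x^T + y y^T\<close> and every form \<open>H\<close> keeps its
  sum.\<close>

lemma exists_isotropic_rotation:
  assumes G: "G \<in> carrier_mat n n" and x: "x \<in> carrier_vec n" and y: "y \<in> carrier_vec n"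
    and pos: "0 < quad_form G x" and neg: "quad_form G y < 0"
  obtains z w where "z \<in> carrier_vec n" "w \<in> carrier_vec n" "quad_form G z = 0"
    and "\<And>H. H \<in> carrier_mat n n \<Longrightarrow> quad_form H z + quad_form H w = quad_form H x + quad_form H y"
proof -
  obtain t where t: "quad_form G x + t * (x \<bullet> (G *\<^sub>v y) + y \<bullet> (G *\<^sub>v x)) + t\<^sup>2 * quad_form G y = 0"
    using quadratic_root_of_opposite_signs[OF pos neg] by blast
  define r where "r = 1 / sqrt (1 + t\<^sup>2)"
  have r: "r\<^sup>2 * (1 + t\<^sup>2) = 1"
    by (simp add: r_def power_divide add_pos_nonneg less_imp_neq[symmetric])
  define z w where "z = r \<cdot>\<^sub>v x + (r * t) \<cdot>\<^sub>v y" and "w = (r * t) \<cdot>\<^sub>v x + (- r) \<cdot>\<^sub>v y"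
  show ?thesis
  proof
    show "z \<in> carrier_vec n" "w \<in> carrier_vec n"
      using x y by (simp_all add: z_def w_def)
    have "quad_form G z
      = r\<^sup>2 * (quad_form G x + t * (x \<bullet> (G *\<^sub>v y) + y \<bullet> (G *\<^sub>v x)) + t\<^sup>2 * quad_form G y)"
      unfolding z_def quad_form_lincomb[OF G x y] by (simp add: power2_eq_square algebra_simps)
    then show "quad_form G z = 0"
      using t by simp
    fix H :: "real mat" assume H: "H \<in> carrier_mat n n"
    have "quad_form H z + quad_form H w = r\<^sup>2 * (1 + t\<^sup>2) * (quad_form H x + quad_form H y)"
      unfolding z_def w_def quad_form_lincomb[OF H x y]
      by (simp add: power2_eq_square algebra_simps)
    then show "quad_form H z + quad_form H w = quad_form H x + quad_form H y"
      using r by simp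
  qed
qed

text \<open>Induction on the length of the list: each round either finds the vector or replaces
  \<open>x\<close> and \<open>y\<close> by the single vector \<open>w\<close>.\<close>

lemma exists_vec_of_sum_list_quad_form:
  assumes G: "G \<in> carrier_mat n n" and H: "H \<in> carrier_mat n n"
    and "set vs \<subseteq> carrier_vec n"
    and "(\<Sum>v\<leftarrow>vs. quad_form G v) \<le> 0" and "(\<Sum>v\<leftarrow>vs. quad_form H v) < 0"
  shows "\<exists>v\<in>carrier_vec n. quad_form G v \<le> 0 \<and> quad_form H v < 0"
  using assms(3-)
proof (induction "length vs" arbitrary: vs rule: less_induct)
  case less
  show ?case
  proof (cases "\<forall>v\<in>set vs. quad_form G v \<le> 0")
    case True
    have "\<exists>v\<in>set vs. quad_form H v < 0"
    proof (rule ccontr)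
      assume "\<not> ?thesis"
      then have "0 \<le> (\<Sum>v\<leftarrow>vs. quad_form H v)"
        by (intro sum_list_nonneg) auto
      then show False using less.prems by simp
    qed
    then show ?thesis using True less.prems by blast
  next
    case False
    then obtain x where x: "x \<in> set vs" "0 < quad_form G x"
      by (auto simp: not_le)
    define us where "us = remove1 x vs"
    have vs_us: "(\<Sum>v\<leftarrow>vs. quad_form B v) = quad_form B x + (\<Sum>v\<leftarrow>us. quad_form B v)" for B
      using sum_list_map_remove1[OF x(1)] by (simp add: us_def)
    \<comment> \<open>The positive contribution of \<open>x\<close> to a nonpositive sum must be
      compensated by a negative one.\<close>
    have "\<exists>y\<in>set us. quad_form G y < 0"
    proof (rule ccontr)
      assume "\<not> ?thesis"
      then have "0 \<le> (\<Sum>v\<leftarrow>us. quad_form G v)"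
        by (intro sum_list_nonneg) auto
      then show False using less.prems x vs_us[of G] by simp
    qed
    then obtain y where y: "y \<in> set us" "quad_form G y < 0" by blast
    define ws where "ws = remove1 y us"
    have us_ws: "(\<Sum>v\<leftarrow>us. quad_form B v) = quad_form B y + (\<Sum>v\<leftarrow>ws. quad_form B v)" for B
      using sum_list_map_remove1[OF y(1)] by (simp add: ws_def)
    have sub: "set us \<subseteq> set vs" "set ws \<subseteq> set us"
      by (auto simp: us_def ws_def set_remove1_subset)
    have len: "length (w # ws) < length vs" for w
      using length_pos_if_in_set[OF x(1)] length_pos_if_in_set[OF y(1)] x(1) y(1)
      by (simp add: us_def ws_def length_remove1)
    obtain z w where zw: "z \<in> carrier_vec n" "w \<in> carrier_vec n" "quad_form G z = 0"
      and eq: "\<And>B. B \<in> carrier_mat n n \<Longrightarrow>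
        quad_form B z + quad_form B w = quad_form B x + quad_form B y"
      using exists_isotropic_rotation[OF G _ _ x(2) y(2)] x y sub less.prems(1) by blast
    show ?thesis
    proof (cases "quad_form H z < 0")
      case True
      then show ?thesis using zw by (intro bexI[of _ z]) simp_all
    next
      case False
      \<comment> \<open>Dropping \<open>z\<close> leaves the \<open>G\<close>-sum unchanged, as
        \<open>z\<close> is isotropic, and cannot raise the \<open>H\<close>-sum, as its
        \<open>H\<close>-form is nonnegative.\<close>
      show ?thesis
      proof (rule less.hyps[OF len])
        show "set (w # ws) \<subseteq> carrier_vec n"
          using zw sub less.prems(1) by auto
        show "(\<Sum>v\<leftarrow>w # ws. quad_form G v) \<le> 0"
          using eq[OF G] vs_us[of G] us_ws[of G] zw less.prems(2) by simp
        show "(\<Sum>v\<leftarrow>w # ws. quad_form H v) < 0"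
          using eq[OF H] vs_us[of H] us_ws[of H] False less.prems(3) by simp
      qed
    qed
  qed
qed

section \<open>Comparison of the two programs\<close>

lemma exists_qcqp_feasible_below:
  assumes Q0: "Q0 \<in> carrier_mat n n" and Q1: "Q1 \<in> carrier_mat n n"
    and Y: "Y \<in> sdp_feasible n Q1" and c: "mat_trace (Q0 * Y) < c"
  shows "\<exists>v\<in>qcqp_feasible n Q1. quad_form Q0 v < c"
proof -
  have Yc: "Y \<in> carrier_mat n n" and psd: "sym_pos_semidef n Y"
    and tr1: "mat_trace (Q1 * Y) \<le> - 1" and tr: "mat_trace Y = 1"
    using Y by (auto simp: sdp_feasible_def sym_mats_def)
  obtain vs where vs: "set vs \<subseteq> carrier_vec n"
    and dec: "\<And>i j. i < n \<Longrightarrow> j < n \<Longrightarrow> Y $$ (i, j) = (\<Sum>v\<leftarrow>vs. v $ i * v $ j)"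
    using sym_pos_semidef_rank_one_decomposition[OF psd] by blast
  have shifted: "(\<Sum>v\<leftarrow>vs. quad_form (B + s \<cdot>\<^sub>m 1\<^sub>m n) v) = mat_trace (B * Y) + s"
    if B: "B \<in> carrier_mat n n" for B s
  proof -
    have "(\<Sum>v\<leftarrow>vs. quad_form (B + s \<cdot>\<^sub>m 1\<^sub>m n) v) = (\<Sum>v\<leftarrow>vs. quad_form B v + s * (v \<bullet> v))"
      using vs by (intro arg_cong[where f = sum_list] map_cong refl quad_form_add_smult_one[OF B]) auto
    also have "\<dots> = mat_trace (B * Y) + s * mat_trace Y"
      using mat_trace_mult_rank_one_sum[OF B Yc vs] mat_trace_rank_one_sum[OF Yc vs] dec
      by (simp add: sum_list_addf sum_list_const_mult)
    finally show ?thesis using tr by simp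
  qed
  \<comment> \<open>Since \<open>Tr Y = 1\<close>, the constants \<open>-1\<close> and
    \<open>c\<close> can be absorbed as multiples of the identity. The resulting sign conditions are
    homogeneous and survive rescaling of a vector.\<close>
  define G where "G = Q1 + 1 \<cdot>\<^sub>m 1\<^sub>m n"
  define H where "H = Q0 + (- c) \<cdot>\<^sub>m 1\<^sub>m n"
  have "\<exists>v\<in>carrier_vec n. quad_form G v \<le> 0 \<and> quad_form H v < 0"
  proof (rule exists_vec_of_sum_list_quad_form[OF _ _ vs])
    show "G \<in> carrier_mat n n" "H \<in> carrier_mat n n"
      using Q0 Q1 by (simp_all add: G_def H_def)
    show "(\<Sum>v\<leftarrow>vs. quad_form G v) \<le> 0" "(\<Sum>v\<leftarrow>vs. quad_form H v) < 0"
      unfolding G_def H_def shifted[OF Q0] shifted[OF Q1] using tr1 c by simp_all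
  qed
  then obtain v where v: "v \<in> carrier_vec n"
    and "quad_form G v \<le> 0" "quad_form H v < 0" by blast
  then have q: "quad_form Q1 v \<le> - (v \<bullet> v)" "quad_form Q0 v < c * (v \<bullet> v)"
    by (simp_all add: G_def H_def quad_form_add_smult_one[OF Q0] quad_form_add_smult_one[OF Q1])
  \<comment> \<open>The strict \<open>H\<close>-inequality rules out the zero vector, so
    \<open>v\<close> can be normalised.\<close>
  have "v \<noteq> 0\<^sub>v n"
    using q(2) Q0 by (auto simp: quad_form_def)
  then obtain i where "i < n" "v $ i \<noteq> 0"
    using v by (metis carrier_vecD eq_vecI index_zero_vec)
  then have "0 < (\<Sum>i<n. v $ i * v $ i)"
    by (intro sum_pos2[of _ i]) (auto simp: zero_less_mult_iff)
  then have vv: "0 < v \<bullet> v"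
    using v by (simp add: scalar_prod_def atLeast0LessThan)
  define a where "a = 1 / sqrt (v \<bullet> v)"
  have a: "a\<^sup>2 = 1 / (v \<bullet> v)"
    using vv by (simp add: a_def power_divide)
  have "quad_form Q1 (a \<cdot>\<^sub>v v) \<le> - 1" "quad_form Q0 (a \<cdot>\<^sub>v v) < c"
    unfolding quad_form_smult_vec[OF Q1 v] quad_form_smult_vec[OF Q0 v] a
    using q vv by (simp_all add: field_simps)
  moreover have "(a \<cdot>\<^sub>v v) \<bullet> (a \<cdot>\<^sub>v v) = 1"
    using v vv a by (simp add: power2_eq_square mult.assoc[symmetric])
  ultimately show ?thesis
    using v by (intro bexI[of _ "a \<cdot>\<^sub>v v"]) (auto simp: qcqp_feasible_def)
qed

text \<open>The witness is \<open>v v^T\<close>, whose form at \<open>x\<close> is the square of the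
  inner product of \<open>x\<close> and \<open>v\<close>. It gives the relaxation
  inequality.\<close>

lemma qcqp_feasible_lift:
  assumes Q1: "Q1 \<in> carrier_mat n n" and v: "v \<in> qcqp_feasible n Q1"
  shows "\<exists>Y\<in>sdp_feasible n Q1. \<forall>Q0\<in>carrier_mat n n. mat_trace (Q0 * Y) = quad_form Q0 v"
proof -
  define Y where "Y = mat n n (\<lambda>(i, j). v $ i * v $ j)"
  have Yc: "Y \<in> carrier_mat n n" by (simp add: Y_def)
  have vc: "v \<in> carrier_vec n" and q: "quad_form Q1 v \<le> - 1" "v \<bullet> v = 1"
    using v by (auto simp: qcqp_feasible_def)
  have dec: "Y $$ (i, j) = (\<Sum>w\<leftarrow>[v]. w $ i * w $ j)" if "i < n" "j < n" for i j
    using that by (simp add: Y_def)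
  have tr: "mat_trace (B * Y) = quad_form B v" if "B \<in> carrier_mat n n" for B
    using mat_trace_mult_rank_one_sum[OF that Yc _ dec] vc by simp
  have sym: "Y \<in> sym_mats n"
    by (auto simp: sym_mats_def Y_def)
  have "0 \<le> quad_form Y x" if "x \<in> carrier_vec n" for x
  proof -
    have "quad_form Y x = (\<Sum>i<n. x $ i * v $ i)\<^sup>2"
      unfolding quad_form_sum[OF Yc that] power2_eq_square sum_product
      by (intro sum.cong refl) (simp add: Y_def)
    then show ?thesis by simp
  qed
  then have "Y \<in> sdp_feasible n Q1"
    using sym q tr[OF Q1] mat_trace_rank_one_sum[OF Yc _ dec] vc
    by (simp add: sdp_feasible_def sym_pos_semidef_def)
  then show ?thesis using tr by blast
qed

lemma qcqp_value_eq_sdp_value: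
  assumes Q0: "Q0 \<in> carrier_mat n n" and Q1: "Q1 \<in> carrier_mat n n"
  shows "qcqp_value n Q0 Q1 = sdp_value n Q0 Q1"
proof (rule antisym)
  show "sdp_value n Q0 Q1 \<le> qcqp_value n Q0 Q1"
    unfolding sdp_value_def qcqp_value_def
    using qcqp_feasible_lift[OF Q1] Q0 by (intro INF_mono) (metis order_refl)
  show "qcqp_value n Q0 Q1 \<le> sdp_value n Q0 Q1"
    unfolding sdp_value_def
  \<comment> \<open>The slack \<open>\<epsilon>\<close> provides the strict bound \<open>c\<close>,
    so no attainment of infima is involved. If the relaxation is infeasible, its value is
    \<open>\<infinity>\<close> and there is no \<open>Y\<close> to treat.\<close>
  proof (rule INF_greatest, rule ereal_le_epsilon2)
    fix Y and \<epsilon> :: real assume Y: "Y \<in> sdp_feasible n Q1" and "0 < \<epsilon>"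
    then obtain v where "v \<in> qcqp_feasible n Q1" "quad_form Q0 v < mat_trace (Q0 * Y) + \<epsilon>"
      using exists_qcqp_feasible_below[OF Q0 Q1 Y, of "mat_trace (Q0 * Y) + \<epsilon>"] by auto
    then show "qcqp_value n Q0 Q1 \<le> ereal (mat_trace (Q0 * Y)) + ereal \<epsilon>"
      unfolding qcqp_value_def by (intro INF_lower2[of v]) auto
  qed
qed

lemma submatrix_principal_carrier:
  assumes "B \<in> carrier_mat N N" "I \<subseteq> {..<N}"
  shows "submatrix B I I \<in> carrier_mat (card I) (card I)"
proof -
  \<comment> \<open>The dimensions of \<open>submatrix\<close> count the indices below
    \<open>N\<close> that lie in \<open>I\<close>.\<close>
  have "{i. i < N \<and> i \<in> I} = I" using assms by auto
  then show ?thesis using assms by (auto simp: dim_submatrix)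
qed

theorem mainTheorem2:
  fixes N :: nat and M A Q0 Q1 :: "real mat" and \<phi> :: real and I :: "nat set"
  assumes "sym_pos_def N M" and "sym_pos_def N A"
    and "\<phi> > 0"
    and "I \<subseteq> {..<N}" and "I \<noteq> {}"
    and "Q0 = submatrix M I I"
    and "Q1 = (- (1 / \<phi>)) \<cdot>\<^sub>m submatrix A I I"
  shows "qcqp_value (card I) Q0 Q1 = sdp_value (card I) Q0 Q1"
  using assms
  by (auto simp: sym_pos_def_def sym_mats_def
      intro!: qcqp_value_eq_sdp_value smult_carrier_mat submatrix_principal_carrier)

end
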